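(* Let $S\subset\mathbb{R}$ be a finite set of servers, $c:S\to\mathbb{N}$ a capacity, and let $\mathcal{A}$ be any MPFS algorithm for $\mathrm{OFAL}(S,c)$. Then there exists a request sequence $\sigma$ such that $\mathcal{A}(\sigma|S)\ge(2\alpha(S)+1)\,\mathrm{Opt}(\sigma|S)$; in particular the competitive ratio of $\mathcal{A}$ is at least $2\alpha(S)+1$.
   Context: Online facility assignment on a line $\mathrm{OFAL}(S,c)$: $S$ is a finite set of servers at distinct points of $\mathbb{R}$ (identified with their positions), $c:S\to\mathbb{N}$ gives each server a capacity $c(s)\ge1$. A request sequence $\sigma=r_1\cdots r_n$ of points of $\mathbb{R}$ with $n\le\sum_s c(s)$ is revealed one at a time; a server is free if fewer than $c(s)$ requests are matched with it; upon arrival, $r_i$ must be irrevocably matched with a free server $s$ at cost $|r_i-s|$. $\mathcal{A}(\sigma|S)$ is the algorithm's total cost, $\mathrm{Opt}(\sigma|S)$ the minimum total cost of a capacity-respecting offline assignment. $\mathcal{A}$ is $\beta$-competitive if $\mathcal{A}(\sigma|S)\le\beta\,\mathrm{Opt}(\sigma|S)$ for all $\sigma$; the competitive ratio is the infimum of $\beta\ge1$ for which $\mathcal{A}$ is $\beta$-competitive. An algorithm is MPFS (most preferred free servers) if for each request $r_i$ a priority order on all servers is determined solely by the position of $r_i$, and $r_i$ is matched with the free server of highest priority. For $T=\{t_1<\cdots<t_m\}\subseteq S$, $m\ge2$, $L(T)=\frac{t_m-t_1}{\max_u(t_{u+1}-t_u)}$; $L(T)=0$ if $|T|\le1$; $\alpha(S)=\max_{T\subseteq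 S}L(T)$. *)

theory Defs
  imports Complex_Main "HOL-Library.FuncSet" "HOL-Library.Extended_Real"
begin

text \<open>
  Servers are identified with their positions, so a set of servers is a \<^typ>\<open>real set\<close>.
  A deterministic online algorithm is a function \<open>A\<close>: for the list \<open>h\<close> of all earlier requests
  and the current request \<open>r\<close>, the server chosen for \<open>r\<close> is \<open>A h r\<close>. The earlier decisions
  are determined by \<open>A\<close> and \<open>h\<close>, hence need not be recorded separately.
\<close>

type_synonym online_alg = "real list \<Rightarrow> real \<Rightarrow> real"

definition matched :: "online_alg \<Rightarrow> real list \<Rightarrow> nat \<Rightarrow> real" where
  "matched A \<sigma> i = A (take i \<sigma>) (\<sigma> ! i)"

definition load :: "online_alg \<Rightarrow> real list \<Rightarrow> real \<Rightarrow> nat" where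
  "load A \<sigma> s = card {i. i < length \<sigma> \<and> matched A \<sigma> i = s}"

definition free_servers :: "real set \<Rightarrow> (real \<Rightarrow> nat) \<Rightarrow> online_alg \<Rightarrow> real list \<Rightarrow> real set" where
  "free_servers S c A \<sigma> = {s \<in> S. load A \<sigma> s < c s}"

definition request_sequence :: "real set \<Rightarrow> (real \<Rightarrow> nat) \<Rightarrow> real list \<Rightarrow> bool" where
  "request_sequence S c \<sigma> \<longleftrightarrow> length \<sigma> \<le> (\<Sum>s\<in>S. c s)"

definition OFAL_algorithm :: "real set \<Rightarrow> (real \<Rightarrow> nat) \<Rightarrow> online_alg \<Rightarrow> bool" where
  "OFAL_algorithm S c A \<longleftrightarrow>
     (\<forall>h r. request_sequence S c (h @ [r]) \<longrightarrow> A h r \<in> free_servers S c A h)"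

text \<open>
  The priority order at position \<open>x\<close> is the linear order \<open>P x\<close>, where \<open>(s, t) \<in> P x\<close>
  means that \<open>t\<close> has at least the priority of \<open>s\<close>.
\<close>

definition MPFS :: "real set \<Rightarrow> (real \<Rightarrow> nat) \<Rightarrow> online_alg \<Rightarrow> bool" where
  "MPFS S c A \<longleftrightarrow> OFAL_algorithm S c A \<and>
     (\<exists>P :: real \<Rightarrow> real rel.
        (\<forall>x. linear_order_on S (P x)) \<and>
        (\<forall>h r. request_sequence S c (h @ [r]) \<longrightarrow>
           (\<forall>s \<in> free_servers S c A h. (s, A h r) \<in> P r)))"

definition alg_cost :: "online_alg \<Rightarrow> real list \<Rightarrow> real" where
  "alg_cost A \<sigma> = (\<Sum>i<length \<sigma>. \<bar>\<sigma> ! i - matched A \<sigma> i\<bar>)"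

definition offline_assignments :: "real set \<Rightarrow> (real \<Rightarrow> nat) \<Rightarrow> nat \<Rightarrow> (nat \<Rightarrow> real) set" where
  "offline_assignments S c n =
     {f \<in> {..<n} \<rightarrow>\<^sub>E S. \<forall>s\<in>S. card {i. i < n \<and> f i = s} \<le> c s}"

text \<open>
  For finite \<open>S\<close> and a request sequence whose length respects the total capacity, the minimum
  below ranges over a finite nonempty set.
\<close>

definition opt_cost :: "real set \<Rightarrow> (real \<Rightarrow> nat) \<Rightarrow> real list \<Rightarrow> real" where
  "opt_cost S c \<sigma> =
     Min ((\<lambda>f. \<Sum>i<length \<sigma>. \<bar>\<sigma> ! i - f i\<bar>) ` offline_assignments S c (length \<sigma>))"

definition competitive :: "real set \<Rightarrow> (real \<Rightarrow> nat) \<Rightarrow> online_alg \<Rightarrow> real \<Rightarrow> bool" where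
  "competitive S c A \<beta> \<longleftrightarrow>
     (\<forall>\<sigma>. request_sequence S c \<sigma> \<longrightarrow> alg_cost A \<sigma> \<le> \<beta> * opt_cost S c \<sigma>)"

text \<open>Extended reals make the ratio \<open>\<infinity>\<close> when the algorithm is not competitive for any \<open>\<beta>\<close>.\<close>

definition competitive_ratio :: "real set \<Rightarrow> (real \<Rightarrow> nat) \<Rightarrow> online_alg \<Rightarrow> ereal" where
  "competitive_ratio S c A = Inf {ereal \<beta> | \<beta>. 1 \<le> \<beta> \<and> competitive S c A \<beta>}"

definition L :: "real set \<Rightarrow> real" where
  "L T = (if card T \<le> 1 then 0
          else let t = sorted_list_of_set T; m = card T in
            (t ! (m - 1) - t ! 0) / Max ((\<lambda>u. t ! Suc u - t ! u) ` {..<m - 1}))"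

definition alpha :: "real set \<Rightarrow> real" where
  "alpha S = Max (L ` Pow S)"

end

theory Submission
  imports Defs
begin

text \<open>
  If some server is not the favourite of its own position, one request there is enough. Otherwise
  requests at server positions fill any server at no cost, so take unit capacities on
  \<open>T = {t\<^sub>1 < \<dots> < t\<^sub>m}\<close> with \<open>L T = \<alpha>(S)\<close>. Request a point \<open>x\<close> in a gap \<open>[a, b]\<close>, then
  repeatedly the server just taken; stopping when the last server taken is \<open>a\<close> or \<open>b\<close>, the
  offline cost is at most \<open>\<bar>x - a\<bar>\<close> or \<open>\<bar>x - b\<bar>\<close>. If from \<open>a\<close> the adversary can drive the walk
  to \<open>t\<^sub>1\<close> before \<open>b\<close>, and from \<open>b\<close> to \<open>t\<^sub>m\<close> before \<open>a\<close>, then a suitable \<open>x\<close> gives the ratio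
  \<open>2 L T + 1\<close> in both cases. Such a gap exists because the servers can be labelled, \<open>t\<^sub>1\<close> and
  \<open>t\<^sub>m\<close> differently, so that every differently labelled pair has this property.
\<close>

section \<open>Walks in preference graphs and the labelling of servers\<close>

text \<open>
  The moves that the adversary can force before the target \<open>b\<close> is taken: \<open>b\<close> stays free, and
  a free server preferred to \<open>b\<close> can be made the favourite by filling the others.
\<close>

definition pref_graph :: "('a \<Rightarrow> 'a rel) \<Rightarrow> 'a set \<Rightarrow> 'a \<Rightarrow> 'a rel" where
  "pref_graph P F b = {(z, v). v \<in> F \<and> v \<noteq> b \<and> (b, v) \<in> P z}"

text \<open>Numeric ranks, smaller meaning preferred, let a contraction rank the merged vertex by a
  minimum.\<close>

abbreviation rank_graph :: "('a \<Rightarrow> 'a \<Rightarrow> nat) \<Rightarrow> 'a set \<Rightarrow> 'a \<Rightarrow> 'a rel" where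
  "rank_graph r \<equiv> pref_graph (\<lambda>z. {(b, v). r z v \<le> r z b})"

text \<open>Cut the walk at its last visit to \<open>w\<close>. The rest survives the deletion
  because only heads of edges must lie in \<open>F\<close>, so \<open>w\<close> may still be its
  start.\<close>

lemma pref_graph_avoid_or_restart:
  assumes "(z, p) \<in> (pref_graph P F b)\<^sup>*"
  shows "(z, p) \<in> (pref_graph P (F - {w}) b)\<^sup>* \<or> (w, p) \<in> (pref_graph P (F - {w}) b)\<^sup>*"
  using assms
proof (induction rule: converse_rtrancl_induct)
  case base
  then show ?case by simp
next
  case (step y z)
  show ?case
  proof (cases "z = w")
    case True
    then show ?thesis using step.IH by blast
  next
    case False
    then have "(y, z) \<in> pref_graph P (F - {w}) b"
      using step.hyps by (auto simp: pref_graph_def)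
    then show ?thesis
      using step.IH by (meson converse_rtrancl_into_rtrancl)
  qed
qed

text \<open>
  Induction on \<open>V\<close>: contract any \<open>y \<notin> {p, q}\<close> into its favourite \<open>w\<close>, ranking the contracted
  vertex by the better of \<open>y\<close> and \<open>w\<close>, and give \<open>y\<close> the label of \<open>w\<close>. A walk that arrives at
  \<open>y\<close> can always continue to \<open>w\<close>, and a walk that avoids the contracted vertex avoids both.
\<close>

lemma rank_labelling:
  fixes r :: "'a \<Rightarrow> 'a \<Rightarrow> nat"
  assumes "finite V" "p \<in> V" "q \<in> V" "p \<noteq> q"
  shows "\<exists>l. l p \<and> \<not> l q \<and>
    (\<forall>a\<in>V. \<forall>b\<in>V. l a \<longrightarrow> \<not> l b \<longrightarrow>
       (a, p) \<in> (rank_graph r V b)\<^sup>* \<and> (b, q) \<in> (rank_graph r V a)\<^sup>*)"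
  using assms
proof (induction "card V" arbitrary: V r)
  case 0
  then show ?case by auto
next
  case (Suc n)
  show ?case
  proof (cases "V = {p, q}")
    case True
    then show ?thesis
      using \<open>p \<noteq> q\<close> by (intro exI[of _ "\<lambda>v. v = p"]) auto
  next
    case False
    then obtain y where y: "y \<in> V" "y \<noteq> p" "y \<noteq> q"
      using Suc.prems by blast
    obtain w where w: "w \<in> V - {y}" "\<And>v. v \<in> V - {y} \<Longrightarrow> r y w \<le> r y v"
      using y Suc.prems ex_has_least_nat[of "\<lambda>v. v \<in> V - {y}" p "r y"] by auto
    define V' where "V' = V - {y}"
    define r' where "r' z v = (if v = w then min (r z w) (r z y) else r z v)" for z v
    have "n = card V'" "finite V'" "p \<in> V'" "q \<in> V'"
      using Suc y by (auto simp: V'_def)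
    from Suc.hyps(1)[OF this \<open>p \<noteq> q\<close>, of r'] obtain l where
      l: "l p" "\<not> l q" and lab: "\<And>a b. a \<in> V' \<Longrightarrow> b \<in> V' \<Longrightarrow> l a \<Longrightarrow> \<not> l b \<Longrightarrow>
         (a, p) \<in> (rank_graph r' V' b)\<^sup>* \<and> (b, q) \<in> (rank_graph r' V' a)\<^sup>*"
      by blast
    define l' where "l' = l(y := l w)"
    have yw: "(y, w) \<in> rank_graph r V b" if "b \<in> V'" "b \<noteq> w" for b
      using that w by (auto simp: pref_graph_def V'_def)
    have lift: "(rank_graph r' V' b)\<^sup>* \<subseteq> (rank_graph r V b)\<^sup>*" if "b \<in> V'" for b
    proof (rule rtrancl_subset_rtrancl, rule subrelI)
      fix z v
      assume zv: "(z, v) \<in> rank_graph r' V' b"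
      show "(z, v) \<in> (rank_graph r V b)\<^sup>*"
      proof (cases "v = w")
        case False
        then have "(z, v) \<in> rank_graph r V b"
          using zv by (auto simp: pref_graph_def V'_def r'_def split: if_splits)
        then show ?thesis by blast
      next
        case True
        with zv have "b \<noteq> w" by (auto simp: pref_graph_def)
        then consider "r z w \<le> r z b" | "r z y \<le> r z b"
          using zv True by (auto simp: pref_graph_def r'_def min_def split: if_splits)
        then show ?thesis
        proof cases
          case 1
          then have "(z, v) \<in> rank_graph r V b"
            using True \<open>b \<noteq> w\<close> w by (auto simp: pref_graph_def)
          then show ?thesis by blast
        next
          case 2
          then have "(z, y) \<in> rank_graph r V b"
            using y that by (auto simp: pref_graph_def V'_def)
          then show ?thesis
            using yw[OF that \<open>b \<noteq> w\<close>] True by (meson converse_rtrancl_into_rtrancl r_into_rtrancl)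
        qed
      qed
    qed
    \<comment> \<open>A vertex that beats the merged \<open>w\<close> has a rank at most the minimum
      of both, so it also beats \<open>y\<close>.\<close>
    have lift_y: "(rank_graph r' V' w)\<^sup>* \<subseteq> (rank_graph r V y)\<^sup>*"
      by (rule rtrancl_mono) (auto simp: pref_graph_def V'_def r'_def split: if_splits)
    \<comment> \<open>One claim for both ends: \<open>e\<close> stands for \<open>p\<close> or
      \<open>q\<close>, and \<open>a0\<close>, \<open>b0\<close> only record labels. A start
      \<open>y\<close> moves on to \<open>w\<close>, which is not the target since the labels
      differ; a target \<open>y\<close> is replaced by \<open>w\<close>.\<close>
    have reach: "(a, e) \<in> (rank_graph r V b)\<^sup>*"
      if "a \<in> V" "b \<in> V" "l' a \<noteq> l' b"
        and red: "\<And>a b. a \<in> V' \<Longrightarrow> b \<in> V' \<Longrightarrow> l a = l' a0 \<Longrightarrow> l b = l' b0 \<Longrightarrow>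
               (a, e) \<in> (rank_graph r' V' b)\<^sup>*"
        and eq: "l' a = l' a0" "l' b = l' b0" for a b e a0 b0
    proof -
      have wV: "w \<in> V'" using w by (simp add: V'_def)
      have "a \<in> V" "b \<in> V" "a \<noteq> b" using that by auto
      then consider "a = y" "b \<in> V'" | "a \<in> V'" "b = y" | "a \<in> V'" "b \<in> V'"
        unfolding V'_def by blast
      then show ?thesis
      proof cases
        case 1
        then have bw: "b \<noteq> w" and "l w = l' a0" "l b = l' b0"
          using that by (auto simp: l'_def V'_def)
        then have "(w, e) \<in> (rank_graph r V b)\<^sup>*"
          using red[OF wV \<open>b \<in> V'\<close>] lift[OF \<open>b \<in> V'\<close>] by blast
        then show ?thesis
          using yw[OF \<open>b \<in> V'\<close> bw] 1 by (meson converse_rtrancl_into_rtrancl)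
      next
        case 2
        then have "l a = l' a0" "l w = l' b0"
          using eq y by (auto simp: l'_def V'_def)
        then show ?thesis
          using red[OF \<open>a \<in> V'\<close> wV] lift_y 2 by blast
      next
        case 3
        then have "l a = l' a0" "l b = l' b0"
          using eq y by (auto simp: l'_def V'_def)
        then show ?thesis
          using red[OF 3] lift[OF \<open>b \<in> V'\<close>] by blast
      qed
    qed
    show ?thesis
    proof (intro exI[of _ l'] conjI ballI impI)
      show "l' p" "\<not> l' q" using l y by (auto simp: l'_def)
    next
      fix a b
      assume ab: "a \<in> V" "b \<in> V" "l' a" "\<not> l' b"
      show "(a, p) \<in> (rank_graph r V b)\<^sup>*"
        by (rule reach[where a0 = a and b0 = b]) (use ab lab in auto)
      show "(b, q) \<in> (rank_graph r V a)\<^sup>*"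
        by (rule reach[where a0 = b and b0 = a]) (use ab lab in auto)
    qed
  qed
qed

text \<open>If \<open>v\<close> were strictly below \<open>b\<close>, the up-set of \<open>b\<close>
  would be a proper subset of that of \<open>v\<close>; so up-set sizes serve as ranks.\<close>

lemma linear_order_rank:
  assumes "finite S" "linear_order_on S R" "b \<in> S" "v \<in> S"
    and "card {s \<in> S. (v, s) \<in> R} \<le> card {s \<in> S. (b, s) \<in> R}"
  shows "(b, v) \<in> R"
proof (rule ccontr)
  assume bv: "(b, v) \<notin> R"
  have R: "refl_on S R" "trans R" "antisym R" "total_on S R"
    using assms(2) by (auto simp: order_on_defs)
  then have "b \<noteq> v" using bv assms(3) by (auto simp: refl_on_def)
  then have "(v, b) \<in> R"
    using bv R(4) assms(3,4) by (auto simp: total_on_def)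
  then have "{s \<in> S. (b, s) \<in> R} \<subseteq> {s \<in> S. (v, s) \<in> R}" "v \<notin> {s \<in> S. (b, s) \<in> R}"
      "v \<in> {s \<in> S. (v, s) \<in> R}"
    using bv R assms by (auto simp: refl_on_def dest: transD)
  then have "{s \<in> S. (b, s) \<in> R} \<subset> {s \<in> S. (v, s) \<in> R}" by blast
  then have "card {s \<in> S. (b, s) \<in> R} < card {s \<in> S. (v, s) \<in> R}"
    using assms(1) by (intro psubset_card_mono) auto
  then show False using assms(5) by simp
qed

lemma preference_labelling:
  assumes "finite S" "\<And>x. linear_order_on S (P x)" "V \<subseteq> S" "p \<in> V" "q \<in> V" "p \<noteq> q"
  obtains l where "l p" "\<not> l q"
    "\<And>a b. a \<in> V \<Longrightarrow> b \<in> V \<Longrightarrow> l a \<Longrightarrow> \<not> l b \<Longrightarrow>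
       (a, p) \<in> (pref_graph P V b)\<^sup>* \<and> (b, q) \<in> (pref_graph P V a)\<^sup>*"
proof -
  define r where "r z v = card {s \<in> S. (v, s) \<in> P z}" for z v
  have sub: "(rank_graph r V b)\<^sup>* \<subseteq> (pref_graph P V b)\<^sup>*" if "b \<in> V" for b
    using assms(3) that
    by (intro rtrancl_mono)
      (auto simp: pref_graph_def r_def intro!: linear_order_rank[OF assms(1,2)])
  have "finite V" using assms finite_subset by blast
  from rank_labelling[OF this assms(4-6), of r] obtain l where l: "l p" "\<not> l q"
    "\<And>a b. a \<in> V \<Longrightarrow> b \<in> V \<Longrightarrow> l a \<Longrightarrow> \<not> l b \<Longrightarrow>
       (a, p) \<in> (rank_graph r V b)\<^sup>* \<and> (b, q) \<in> (rank_graph r V a)\<^sup>*"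
    by blast
  show ?thesis
    by (rule that[of l]) (use l sub in blast)+
qed

section \<open>Loads, costs and upper bounds on the optimum\<close>

lemma matched_append:
  "i < length h \<Longrightarrow> matched A (h @ [r]) i = matched A h i"
  "matched A (h @ [r]) (length h) = A h r"
  by (auto simp: matched_def nth_append)

lemma load_snoc: "load A (h @ [r]) s = load A h s + (if A h r = s then 1 else 0)"
proof -
  have "{i. i < length (h @ [r]) \<and> matched A (h @ [r]) i = s} =
      {i. i < length h \<and> matched A h i = s} \<union> (if A h r = s then {length h} else {})"
    by (auto simp: less_Suc_eq matched_append)
  then show ?thesis by (simp add: load_def)
qed

lemma load_Nil: "load A [] s = 0"
  by (simp add: load_def)

lemma alg_cost_snoc: "alg_cost A (h @ [r]) = alg_cost A h + \<bar>r - A h r\<bar>"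
  by (simp add: alg_cost_def matched_append nth_append)

lemma alg_cost_Nil: "alg_cost A [] = 0"
  by (simp add: alg_cost_def)

lemma opt_cost_le:
  assumes "finite S" "length g = length \<sigma>" "set g \<subseteq> S" "\<And>s. s \<in> S \<Longrightarrow> count_list g s \<le> c s"
  shows "opt_cost S c \<sigma> \<le> (\<Sum>i<length \<sigma>. \<bar>\<sigma> ! i - g ! i\<bar>)"
proof -
  let ?n = "length \<sigma>"
  \<comment> \<open>Offline assignments are extensional functions, hence
    \<open>restrict\<close>.\<close>
  define f where "f = restrict ((!) g) {..<?n}"
  have "{i. i < ?n \<and> f i = s} = {i. i < length g \<and> g ! i = s}" for s
    using assms(2) by (auto simp: f_def)
  then have "card {i. i < ?n \<and> f i = s} = count_list g s" for s
    by (simp add: count_list_eq_length_filter length_filter_conv_card eq_commute)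
  then have f: "f \<in> offline_assignments S c ?n"
    using assms nth_mem[of _ g] by (auto simp: offline_assignments_def f_def)
  have "finite (offline_assignments S c ?n)"
    using assms(1) by (auto simp: offline_assignments_def intro!: finite_PiE)
  then have "opt_cost S c \<sigma> \<le> (\<Sum>i<?n. \<bar>\<sigma> ! i - f i\<bar>)"
    unfolding opt_cost_def using f by (intro Min_le) auto
  also have "\<dots> = (\<Sum>i<?n. \<bar>\<sigma> ! i - g ! i\<bar>)"
    by (intro sum.cong) (auto simp: f_def)
  finally show ?thesis .
qed

lemma list_with_counts:
  assumes "finite S"
  obtains h where "set h \<subseteq> S" "\<And>s. s \<in> S \<Longrightarrow> count_list h s = k s" "length h = sum k S"
proof -
  have "\<exists>h. set h \<subseteq> S \<and> (\<forall>s\<in>S. count_list h s = k s) \<and> length h = sum k S"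
    using assms
  proof (induction S)
    case empty
    then show ?case by auto
  next
    case (insert x S)
    then obtain h where h: "set h \<subseteq> S" "\<forall>s\<in>S. count_list h s = k s" "length h = sum k S"
      by blast
    have rep: "count_list (replicate (k x) x) s = (if s = x then k x else 0)" for s
      by (induction "k x") (auto simp: count_list_eq_length_filter)
    have "count_list h x = 0"
      using h(1) insert.hyps by (auto simp: count_list_0_iff)
    then show ?case
      using h insert.hyps rep by (intro exI[of _ "replicate (k x) x @ h"]) auto
  qed
  then show ?thesis using that by blast
qed

section \<open>Algorithms for which every server is the favourite of its own position\<close>

locale self_preferring =
  fixes S :: "real set" and c :: "real \<Rightarrow> nat" and A :: online_alg and P :: "real \<Rightarrow> real rel"
  assumes finite_S: "finite S"
    and capacity: "s \<in> S \<Longrightarrow> 1 \<le> c s"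
    and algorithm: "OFAL_algorithm S c A"
    and lin: "linear_order_on S (P x)"
    and priority: "request_sequence S c (h @ [r]) \<Longrightarrow> s \<in> free_servers S c A h \<Longrightarrow> (s, A h r) \<in> P r"
    and self: "s \<in> S \<Longrightarrow> t \<in> S \<Longrightarrow> (t, s) \<in> P s"
begin

lemma P_antisym: "(s, t) \<in> P x \<Longrightarrow> (t, s) \<in> P x \<Longrightarrow> s = t"
  using lin[of x] by (auto simp: order_on_defs dest: antisymD)

lemma A_free: "request_sequence S c (h @ [r]) \<Longrightarrow> A h r \<in> free_servers S c A h"
  using algorithm by (auto simp: OFAL_algorithm_def)

lemma A_self:
  assumes "request_sequence S c (h @ [s])" "s \<in> free_servers S c A h"
  shows "A h s = s"
proof (rule P_antisym)
  show "(s, A h s) \<in> P s" using priority assms by blast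
  show "(A h s, s) \<in> P s"
    using self A_free[OF assms(1)] assms(2) by (auto simp: free_servers_def)
qed

text \<open>Each request finds its own server free, since the load so far equals the count and is
  still below capacity.\<close>

lemma requests_at_servers:
  assumes "set h \<subseteq> S" "\<And>s. s \<in> S \<Longrightarrow> count_list h s \<le> c s"
  shows "(\<forall>s\<in>S. load A h s = count_list h s) \<and> alg_cost A h = 0"
  using assms
proof (induction h rule: rev_induct)
  case Nil
  then show ?case by (auto simp: load_Nil alg_cost_Nil)
next
  case (snoc r h)
  have le: "count_list h s \<le> c s" if "s \<in> S" for s
    using snoc.prems(2)[OF that] by (simp split: if_splits)
  then have IH: "\<forall>s\<in>S. load A h s = count_list h s" "alg_cost A h = 0"
    using snoc by auto
  have "r \<in> S" using snoc.prems by simp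
  then have free: "r \<in> free_servers S c A h"
    using snoc.prems(2)[of r] IH by (auto simp: free_servers_def)
  have "length (h @ [r]) = (\<Sum>s\<in>S. count_list (h @ [r]) s)"
    using sum_count_set[OF snoc.prems(1) finite_S] by simp
  also have "\<dots> \<le> (\<Sum>s\<in>S. c s)"
    using snoc.prems(2) by (intro sum_mono) auto
  finally have "A h r = r"
    using free A_self by (auto simp: request_sequence_def)
  then show ?case
    using IH by (auto simp: load_snoc alg_cost_snoc)
qed

text \<open>
  \<open>F\<close> is the set of free servers, each of which has room for exactly one more request.
\<close>

definition state :: "real list \<Rightarrow> real set \<Rightarrow> bool" where
  "state h F \<longleftrightarrow> F \<subseteq> S \<and> (\<forall>s\<in>S. load A h s + (if s \<in> F then 1 else 0) = c s) \<and>
     length h + card F = (\<Sum>s\<in>S. c s)"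

text \<open>The load equation makes \<open>F\<close> exactly the set of free servers, and a nonempty
  \<open>F\<close> leaves room for one more request.\<close>

lemma state_step:
  assumes "state h F" "F \<noteq> {}"
  shows "A h r \<in> F" "s \<in> F \<Longrightarrow> (s, A h r) \<in> P r" "state (h @ [r]) (F - {A h r})"
    "r \<in> F \<Longrightarrow> A h r = r"
proof -
  have fin: "finite F"
    using assms finite_S finite_subset by (auto simp: state_def)
  then have "card F > 0" using assms by (simp add: card_gt_0_iff)
  then have rs: "request_sequence S c (h @ [r])"
    using assms by (auto simp: state_def request_sequence_def)
  have free: "free_servers S c A h = F"
  proof -
    have "load A h s < c s \<longleftrightarrow> s \<in> F" if "s \<in> S" for s
      using assms(1) that by (cases "s \<in> F") (auto simp: state_def)
    then show ?thesis
      using assms(1) by (auto simp: state_def free_servers_def)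
  qed
  show AF: "A h r \<in> F" using A_free[OF rs] free by simp
  show "s \<in> F \<Longrightarrow> (s, A h r) \<in> P r" using priority[OF rs] free by simp
  show "r \<in> F \<Longrightarrow> A h r = r" using A_self[OF rs] free by simp
  show "state (h @ [r]) (F - {A h r})"
    using assms(1) AF \<open>card F > 0\<close> fin
    by (fastforce simp: state_def load_snoc)
qed

section \<open>Histories that the adversary can force\<close>

text \<open>
  Some history reaches \<open>state h F\<close> at cost at least \<open>K\<close> in such a way that all requests but one,
  at \<open>x\<close>, are at servers, and assigning these to their own positions and \<open>x\<close> to \<open>z\<close> loads every
  server exactly as the algorithm does.
\<close>

definition forceable :: "real \<Rightarrow> real set \<Rightarrow> real \<Rightarrow> real \<Rightarrow> bool" where
  "forceable x F z K \<longleftrightarrow> (\<exists>h pre post. h = pre @ x # post \<and> set (pre @ post) \<subseteq> S \<and> z \<in> S \<and>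
     state h F \<and> (\<forall>s\<in>S. load A h s = count_list (pre @ z # post) s) \<and> K \<le> alg_cost A h)"

lemma forceable_mono: "forceable x F z K \<Longrightarrow> K' \<le> K \<Longrightarrow> forceable x F z K'"
  unfolding forceable_def by (meson order_trans)

text \<open>Requests at servers first produce the loads of \<open>state h F\<close> at no cost; then
  \<open>x\<close> is requested.\<close>

lemma forceable_start:
  assumes "F \<subseteq> S" "F \<noteq> {}"
  obtains w where "w \<in> F" "forceable x (F - {w}) w \<bar>x - w\<bar>"
proof -
  have fin: "finite F" using assms finite_S finite_subset by blast
  \<comment> \<open>Capacities are at least 1, so the truncated subtraction is exact.\<close>
  define k where "k s = (if s \<in> F then c s - 1 else c s)" for s
  obtain h where h: "set h \<subseteq> S" "\<And>s. s \<in> S \<Longrightarrow> count_list h s = k s" "length h = sum k S"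
    using list_with_counts[OF finite_S, of k] by blast
  have ld: "\<forall>s\<in>S. load A h s = count_list h s" "alg_cost A h = 0"
    using requests_at_servers[OF h(1)] h(2) by (auto simp: k_def)
  have kc: "k s + (if s \<in> F then 1 else 0) = c s" if "s \<in> S" for s
    using capacity[OF that] by (auto simp: k_def)
  have "(\<Sum>s\<in>S. c s) = (\<Sum>s\<in>S. k s + (if s \<in> F then 1 else 0))"
    using kc by (intro sum.cong) auto
  also have "\<dots> = sum k S + card (S \<inter> F)"
    using finite_S by (simp add: sum.distrib sum.If_cases)
  finally have "length h + card F = (\<Sum>s\<in>S. c s)"
    using h(3) assms(1) by (simp add: Int_absorb1)
  then have st: "state h F"
    using assms kc ld h(2) by (auto simp: state_def)
  note step = state_step[OF st assms(2), where r = x]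
  have "forceable x (F - {A h x}) (A h x) \<bar>x - A h x\<bar>"
    unfolding forceable_def
    using step(1,3) h(1) ld assms(1)
    by (intro exI[of _ "h @ [x]"] exI[of _ h] exI[of _ "[]"])
      (auto simp: load_snoc alg_cost_snoc)
  then show ?thesis using that step(1) by blast
qed

text \<open>Request \<open>z\<close> again. Offline, this request takes the place of
  \<open>x\<close> at \<open>z\<close>, and \<open>x\<close> moves to the newly taken
  \<open>w\<close>.\<close>

lemma forceable_chain:
  assumes "forceable x F z K" "F \<noteq> {}"
  obtains w where "w \<in> F" "\<And>s. s \<in> F \<Longrightarrow> (s, w) \<in> P z" "forceable x (F - {w}) w (K + \<bar>z - w\<bar>)"
proof -
  obtain h pre post where h: "h = pre @ x # post" "set (pre @ post) \<subseteq> S" "z \<in> S" "state h F"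
    "\<forall>s\<in>S. load A h s = count_list (pre @ z # post) s" "K \<le> alg_cost A h"
    using assms(1) unfolding forceable_def by blast
  note step = state_step[OF h(4) assms(2), where r = z]
  have "A h z \<in> S" using step(1) h(4) by (auto simp: state_def)
  then have "forceable x (F - {A h z}) (A h z) (K + \<bar>z - A h z\<bar>)"
    unfolding forceable_def
    using step(3) h load_snoc[of A h z] alg_cost_snoc[of A h z]
    by (intro exI[of _ "h @ [z]"] exI[of _ pre] exI[of _ "post @ [z]"]) auto
  then show ?thesis using that step by blast
qed

lemma forceable_fill:
  assumes "forceable x F z K" "v \<in> F"
  shows "forceable x (F - {v}) z K"
proof -
  obtain h pre post where h: "h = pre @ x # post" "set (pre @ post) \<subseteq> S" "z \<in> S" "state h F"
    "\<forall>s\<in>S. load A h s = count_list (pre @ z # post) s" "K \<le> alg_cost A h"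
    using assms(1) unfolding forceable_def by blast
  have "F \<noteq> {}" using assms(2) by auto
  note step = state_step[OF h(4) this, where r = v]
  have "A h v = v" using step(4) assms(2) by blast
  moreover have "v \<in> S" using h(4) assms(2) by (auto simp: state_def)
  ultimately show ?thesis
    unfolding forceable_def
    using step(3) h load_snoc[of A h v] alg_cost_snoc[of A h v]
    by (intro exI[of _ "h @ [v]"] exI[of _ pre] exI[of _ "post @ [v]"]) auto
qed

lemma forceable_finite: "forceable x F z K \<Longrightarrow> finite F"
  unfolding forceable_def state_def using finite_S finite_subset by blast

lemma forceable_fill_all:
  assumes "finite G" "forceable x F z K" "G \<subseteq> F"
  shows "forceable x (F - G) z K"
  using assms
proof (induction G)
  case empty
  then show ?case by simp
next
  case (insert v G)
  then have "forceable x (F - G - {v}) z K"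
    by (intro forceable_fill) auto
  then show ?case by (metis Diff_insert)
qed

text \<open>Once all other free servers are filled, a request at \<open>z\<close> has to go to
  \<open>b\<close>.\<close>

lemma forceable_direct:
  assumes "forceable x F z K" "b \<in> F"
  shows "forceable x {} b (K + \<bar>z - b\<bar>)"
proof -
  have "forceable x (F - (F - {b})) z K"
    using assms forceable_finite[OF assms(1)] by (intro forceable_fill_all) auto
  moreover have "F - (F - {b}) = {b}" using assms(2) by auto
  ultimately have "forceable x {b} z K" by simp
  then show ?thesis by (rule forceable_chain) auto
qed

text \<open>The first edge of the walk shows that the favourite \<open>w\<close> of \<open>z\<close>
  is not \<open>b\<close>. Either the walk can be continued from \<open>w\<close>, or it survives
  from \<open>z\<close> without \<open>w\<close>.\<close>

lemma forceable_via:
  assumes "forceable x F z K" "b \<in> F" "(z, p) \<in> (pref_graph P F b)\<^sup>*"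
  shows "forceable x {} b (K + \<bar>z - p\<bar> + \<bar>p - b\<bar>)"
  using assms
proof (induction "card F" arbitrary: F z K rule: less_induct)
  case less
  show ?case
  proof (cases "z = p")
    case True
    then show ?thesis using forceable_direct less.prems by fastforce
  next
    case False
    then obtain v where "(z, v) \<in> pref_graph P F b"
      using less.prems(3) by (meson converse_rtranclE)
    then have v: "v \<in> F" "v \<noteq> b" "(b, v) \<in> P z" by (auto simp: pref_graph_def)
    obtain w where w: "w \<in> F" "\<And>s. s \<in> F \<Longrightarrow> (s, w) \<in> P z"
      "forceable x (F - {w}) w (K + \<bar>z - w\<bar>)"
      using forceable_chain[OF less.prems(1)] v(1) by blast
    have "w \<noteq> b" using v w(2)[OF v(1)] P_antisym by blast
    then have b: "b \<in> F - {w}" using less.prems by blast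
    have small: "card (F - {w}) < card F"
      using w(1) forceable_finite[OF less.prems(1)] by (intro card_Diff1_less)
    consider "(w, p) \<in> (pref_graph P (F - {w}) b)\<^sup>*" | "(z, p) \<in> (pref_graph P (F - {w}) b)\<^sup>*"
      using pref_graph_avoid_or_restart[OF less.prems(3)] by blast
    then show ?thesis
    proof cases
      case 1
      have "forceable x {} b (K + \<bar>z - w\<bar> + \<bar>w - p\<bar> + \<bar>p - b\<bar>)"
        by (rule less.hyps[OF small w(3) b 1])
      then show ?thesis by (rule forceable_mono) linarith
    next
      \<comment> \<open>Instead of chaining to \<open>w\<close>, fill it at its own position;
        \<open>z\<close> remains the last server on the walk.\<close>
      case 2
      show ?thesis
        by (rule less.hyps[OF small forceable_fill[OF less.prems(1) w(1)] b 2])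
    qed
  qed
qed

text \<open>Let \<open>w\<close> be the server that receives \<open>x\<close>. If no walk can be
  continued from \<open>w\<close>, both avoid it, and \<open>w\<close> is filled before
  \<open>x\<close> is requested.\<close>

lemma forceable_either:
  assumes "F \<subseteq> S" "a \<in> F" "b \<in> F" "p \<noteq> b" "q \<noteq> a" "a \<noteq> b"
    and "(a, p) \<in> (pref_graph P F b)\<^sup>*" "(b, q) \<in> (pref_graph P F a)\<^sup>*"
  shows "forceable x {} b (\<bar>x - p\<bar> + \<bar>p - b\<bar>) \<or> forceable x {} a (\<bar>x - q\<bar> + \<bar>q - a\<bar>)"
  using assms
proof (induction "card F" arbitrary: F rule: less_induct)
  case less
  have fin: "finite F" using less.prems(1) finite_S finite_subset by blast
  obtain w where w: "w \<in> F" "forceable x (F - {w}) w \<bar>x - w\<bar>"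
    using forceable_start[of F] less.prems by blast
  note avoid = pref_graph_avoid_or_restart[where w = w]
  consider (left) "w \<noteq> b" "(w, p) \<in> (pref_graph P (F - {w}) b)\<^sup>*"
    | (right) "w \<noteq> a" "(w, q) \<in> (pref_graph P (F - {w}) a)\<^sup>*"
    | (neither) "w \<noteq> a" "w \<noteq> b" "(a, p) \<in> (pref_graph P (F - {w}) b)\<^sup>*"
        "(b, q) \<in> (pref_graph P (F - {w}) a)\<^sup>*"
    using avoid[OF less.prems(7)] avoid[OF less.prems(8)] \<open>a \<noteq> b\<close> by metis
  then show ?case
  proof cases
    case left
    then have "forceable x {} b (\<bar>x - w\<bar> + \<bar>w - p\<bar> + \<bar>p - b\<bar>)"
      using less.prems by (intro forceable_via[OF w(2)]) auto
    then show ?thesis by (intro disjI1, elim forceable_mono) linarith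
  next
    case right
    then have "forceable x {} a (\<bar>x - w\<bar> + \<bar>w - q\<bar> + \<bar>q - a\<bar>)"
      using less.prems by (intro forceable_via[OF w(2)]) auto
    then show ?thesis by (intro disjI2, elim forceable_mono) linarith
  next
    case neither
    have "card (F - {w}) < card F" using w(1) fin by (intro card_Diff1_less)
    then show ?thesis
      by (rule less.hyps) (use neither less.prems in auto)
  qed
qed

lemma forceable_finish:
  assumes "forceable x F z K"
  obtains \<sigma> where "request_sequence S c \<sigma>" "K \<le> alg_cost A \<sigma>" "opt_cost S c \<sigma> \<le> \<bar>x - z\<bar>"
proof -
  obtain h pre post where h: "h = pre @ x # post" "set (pre @ post) \<subseteq> S" "z \<in> S" "state h F"
    "\<forall>s\<in>S. load A h s = count_list (pre @ z # post) s" "K \<le> alg_cost A h"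
    using assms(1) unfolding forceable_def by blast
  let ?g = "pre @ z # post"
  have "count_list ?g s \<le> c s" if "s \<in> S" for s
    using h(4,5) that unfolding state_def by (metis le_add1)
  then have "opt_cost S c h \<le> (\<Sum>i<length h. \<bar>h ! i - ?g ! i\<bar>)"
    using h by (intro opt_cost_le finite_S) auto
  also have "\<dots> = (\<Sum>i<length h. if i = length pre then \<bar>x - z\<bar> else 0)"
    using h(1) by (intro sum.cong) (auto simp: nth_append nth_Cons split: nat.splits)
  also have "\<dots> = \<bar>x - z\<bar>" using h(1) by (simp add: sum.delta)
  finally have "opt_cost S c h \<le> \<bar>x - z\<bar>" .
  moreover have "request_sequence S c h"
    using h(4) by (auto simp: state_def request_sequence_def)
  ultimately show ?thesis using that h(6) by blast
qed

text \<open>Positive cost rules out the empty bound 0 \<le> 0 and later forces a positive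
  optimum.\<close>

lemma bad_sequence_of_forceable:
  assumes "forceable x F z K" "0 \<le> R" "R * \<bar>x - z\<bar> \<le> K" "0 < K"
  shows "\<exists>\<sigma>. request_sequence S c \<sigma> \<and> 0 < alg_cost A \<sigma> \<and> R * opt_cost S c \<sigma> \<le> alg_cost A \<sigma>"
proof -
  obtain \<sigma> where \<sigma>: "request_sequence S c \<sigma>" "K \<le> alg_cost A \<sigma>" "opt_cost S c \<sigma> \<le> \<bar>x - z\<bar>"
    using forceable_finish[OF assms(1)] .
  have "R * opt_cost S c \<sigma> \<le> R * \<bar>x - z\<bar>"
    using \<sigma>(3) assms(2) by (rule mult_left_mono)
  then show ?thesis using \<sigma> assms by (intro exI[of _ \<sigma>]) auto
qed

end

section \<open>Choice of the gap and of the request point\<close>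

lemma label_change:
  assumes "l (0::nat)" "\<not> l n"
  obtains u where "u < n" "l u" "\<not> l (Suc u)"
proof -
  have "\<exists>u<n. l u \<and> \<not> l (Suc u)"
  proof (rule ccontr)
    assume *: "\<not> ?thesis"
    have "k \<le> n \<Longrightarrow> l k" for k
      by (induction k) (use * assms in auto)
    then show False using assms by blast
  qed
  then show ?thesis using that by blast
qed

lemma (in self_preferring) bad_sequence:
  assumes "T \<subseteq> S" "card T \<ge> 2"
  shows "\<exists>\<sigma>. request_sequence S c \<sigma> \<and> 0 < alg_cost A \<sigma> \<and>
     (2 * L T + 1) * opt_cost S c \<sigma> \<le> alg_cost A \<sigma>"
proof -
  have fin: "finite T" using assms finite_S finite_subset by blast
  define t where "t = sorted_list_of_set T"
  define n where "n = card T - 1"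
  have t: "set t = T" "length t = Suc n" "sorted_wrt (<) t"
    using fin assms(2) by (auto simp: t_def n_def)
  have n: "0 < n" using assms(2) by (simp add: n_def)
  have mono: "t ! i < t ! j" if "i < j" "j \<le> n" for i j
    using t that sorted_wrt_nth_less by fastforce
  have in_T: "t ! i \<in> T" if "i \<le> n" for i
    using t that nth_mem[of i t] by simp
  define d where "d = Max ((\<lambda>u. t ! Suc u - t ! u) ` {..<n})"
  have gap: "t ! Suc u - t ! u \<le> d" if "u < n" for u
    unfolding d_def using that by (intro Max_ge) auto
  have dpos: "0 < d" using gap[OF n] mono[of 0 "Suc 0"] n by simp
  define p where "p = t ! 0"
  define q where "q = t ! n"
  have L: "L T = (q - p) / d"
    using assms(2) by (simp add: L_def Let_def t_def n_def d_def p_def q_def)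
  have pq: "p < q" "p \<in> T" "q \<in> T"
    using mono[of 0 n] n in_T by (auto simp: p_def q_def)
  obtain l where l: "l p" "\<not> l q" "\<And>a b. a \<in> T \<Longrightarrow> b \<in> T \<Longrightarrow> l a \<Longrightarrow> \<not> l b \<Longrightarrow>
       (a, p) \<in> (pref_graph P T b)\<^sup>* \<and> (b, q) \<in> (pref_graph P T a)\<^sup>*"
    using preference_labelling[of S P T p q] finite_S lin assms(1) pq by blast
  \<comment> \<open>Neighbouring servers with different labels bound the gap in which
    \<open>x\<close> is placed.\<close>
  obtain u where u: "u < n" "l (t ! u)" "\<not> l (t ! Suc u)"
    using label_change[of "\<lambda>i. l (t ! i)" n] l by (auto simp: p_def q_def)
  define a where "a = t ! u"
  define b where "b = t ! Suc u"
  have ab: "a < b" "a \<in> T" "b \<in> T" "b - a \<le> d"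
    using u mono in_T gap by (auto simp: a_def b_def)
  have pa: "p \<le> a"
    using mono[of 0 u] u by (cases "u = 0") (auto simp: p_def a_def)
  have bq: "b \<le> q"
    using mono[of "Suc u" n] u by (cases "Suc u = n") (auto simp: q_def b_def)
  define R where "R = 2 * L T + 1"
  have LT: "0 < L T" using L pq dpos by simp
  then have R: "0 < R" by (simp add: R_def)
  \<comment> \<open>The gap is at most the largest gap \<open>d\<close>, and \<open>L T * d\<close>
    is the whole span.\<close>
  have "L T * (b - a) \<le> L T * d" using LT ab by simp
  also have "\<dots> = q - p" using L dpos by simp
  finally have key: "(R - 1) * (b - a) \<le> 2 * (q - p)" by (simp add: R_def)
  txt \<open>At \<open>x0\<close> the walk through \<open>p\<close> to \<open>b\<close> costs exactly \<open>R\<close> times the offline cost.\<close>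
  define x0 where "x0 = ((R - 1) * b + 2 * p) / (R + 1)"
  \<comment> \<open>Clamping keeps \<open>x\<close> in the gap. Moving right of \<open>x0\<close>
    only helps against \<open>b\<close>, and at \<open>x = a\<close> the offline cost to
    \<open>a\<close> vanishes.\<close>
  define x where "x = max a x0"
  have x0: "(R + 1) * x0 = (R - 1) * b + 2 * p" using R by (simp add: x0_def)
  have "(R + 1) * x0 < (R + 1) * b" using x0 pa ab by (simp add: algebra_simps)
  then have xb: "a \<le> x" "x < b" using R ab by (auto simp: x_def)
  have "(R + 1) * x0 \<le> (R + 1) * x" using R by (simp add: x_def)
  then have left: "R * (b - x) \<le> (x - p) + (b - p)" using x0 by (simp add: algebra_simps)
  have right: "R * (x - a) \<le> (q - x) + (q - a)"
  proof (cases "x = a")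
    case True
    then show ?thesis using ab bq by simp
  next
    case False
    then have "x = x0" by (auto simp: x_def max_def split: if_splits)
    \<comment> \<open>Substituting \<open>x0\<close> turns the claim into
      \<open>key\<close>.\<close>
    then show ?thesis using x0 key by (simp add: algebra_simps)
  qed
  have "(a, p) \<in> (pref_graph P T b)\<^sup>*" "(b, q) \<in> (pref_graph P T a)\<^sup>*"
    using l(3)[OF ab(2,3)] u by (auto simp: a_def b_def)
  then consider "forceable x {} b (\<bar>x - p\<bar> + \<bar>p - b\<bar>)" | "forceable x {} a (\<bar>x - q\<bar> + \<bar>q - a\<bar>)"
    using forceable_either[of T a b p q x] assms(1) ab pa bq by auto
  then show ?thesis
  proof cases
    case 1
    then show ?thesis unfolding R_def[symmetric]
      by (rule bad_sequence_of_forceable) (use R left xb pa ab in \<open>auto simp: abs_if\<close>)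
  next
    case 2
    then show ?thesis unfolding R_def[symmetric]
      by (rule bad_sequence_of_forceable) (use R right xb bq ab in \<open>auto simp: abs_if\<close>)
  qed
qed

section \<open>Remaining cases and the competitive ratio\<close>

lemma alpha_attained:
  assumes "finite S"
  obtains T where "T \<subseteq> S" "alpha S = L T"
proof -
  have "alpha S \<in> L ` Pow S"
    unfolding alpha_def using assms by (intro Max_in) auto
  then show ?thesis using that by blast
qed

lemma alpha_nonneg:
  assumes "finite S"
  shows "0 \<le> alpha S"
proof -
  have "L {} \<le> alpha S"
    unfolding alpha_def using assms by (intro Max_ge) auto
  then show ?thesis by (simp add: L_def)
qed

text \<open>A single request at \<open>s\<close> is sent elsewhere, because \<open>t\<close> is free
  and \<open>s\<close> does not beat it; offline it costs nothing, so any \<open>R\<close>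
  works.\<close>

lemma bad_sequence_not_self_preferring:
  assumes "finite S" "\<And>s. s \<in> S \<Longrightarrow> 1 \<le> c s" "OFAL_algorithm S c A"
    and priority: "\<And>h r s. request_sequence S c (h @ [r]) \<Longrightarrow> s \<in> free_servers S c A h \<Longrightarrow>
       (s, A h r) \<in> P r"
    and st: "s \<in> S" "t \<in> S" "(t, s) \<notin> P s" and "0 \<le> R"
  shows "\<exists>\<sigma>. request_sequence S c \<sigma> \<and> 0 < alg_cost A \<sigma> \<and> R * opt_cost S c \<sigma> \<le> alg_cost A \<sigma>"
proof -
  have "1 \<le> sum c S"
    using assms(2)[OF st(1)] member_le_sum[of s S c] assms(1) st(1) by fastforce
  then have rs: "request_sequence S c ([] @ [s])" by (simp add: request_sequence_def)
  have "t \<in> free_servers S c A []"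
    using assms(2)[OF st(2)] st(2) by (auto simp: free_servers_def load_Nil)
  then have "A [] s \<noteq> s" using priority[OF rs] st(3) by metis
  then have cost: "0 < alg_cost A [s]"
    using alg_cost_snoc[of A "[]" s] by (simp add: alg_cost_Nil)
  have "opt_cost S c [s] \<le> (\<Sum>i<length [s]. \<bar>[s] ! i - [s] ! i\<bar>)"
    by (rule opt_cost_le) (use assms st in auto)
  then have "R * opt_cost S c [s] \<le> 0"
    using \<open>0 \<le> R\<close> by (simp add: mult_nonneg_nonpos)
  then show ?thesis using rs cost by (intro exI[of _ "[s]"]) auto
qed

theorem theorem5:
  fixes S :: "real set" and c :: "real \<Rightarrow> nat" and A :: online_alg
  assumes "finite S"
    and "\<And>s. s \<in> S \<Longrightarrow> 1 \<le> c s"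
    and "MPFS S c A"
  shows "(\<exists>\<sigma>. request_sequence S c \<sigma> \<and>
              (S \<noteq> {} \<longrightarrow> 0 < alg_cost A \<sigma>) \<and>
              (2 * alpha S + 1) * opt_cost S c \<sigma> \<le> alg_cost A \<sigma>) \<and>
         ereal (2 * alpha S + 1) \<le> competitive_ratio S c A"
proof (cases "S = {}")
  case True
  then have R: "2 * alpha S + 1 = 1" by (simp add: alpha_def L_def)
  have "opt_cost S c [] \<le> 0"
    using opt_cost_le[of S "[]" "[]" c] assms(1) by simp
  then have "request_sequence S c [] \<and> (2 * alpha S + 1) * opt_cost S c [] \<le> alg_cost A []"
    unfolding R by (simp add: request_sequence_def alg_cost_Nil)
  moreover have "ereal (2 * alpha S + 1) \<le> competitive_ratio S c A"
    unfolding R competitive_ratio_def by (rule Inf_greatest) auto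
  ultimately show ?thesis using True by blast
next
  case False
  let ?R = "2 * alpha S + 1"
  obtain P where P: "OFAL_algorithm S c A" "\<And>x. linear_order_on S (P x)"
    "\<And>h r s. request_sequence S c (h @ [r]) \<Longrightarrow> s \<in> free_servers S c A h \<Longrightarrow> (s, A h r) \<in> P r"
    using assms(3) unfolding MPFS_def by metis
  have R: "0 \<le> ?R" using alpha_nonneg[OF assms(1)] by simp
  have "\<exists>\<sigma>. request_sequence S c \<sigma> \<and> 0 < alg_cost A \<sigma> \<and> ?R * opt_cost S c \<sigma> \<le> alg_cost A \<sigma>"
  proof (cases "\<forall>s\<in>S. \<forall>t\<in>S. (t, s) \<in> P s")
    case True
    then interpret self_preferring S c A P
      using assms P by unfold_locales auto
    obtain T where T: "T \<subseteq> S" "alpha S = L T" using alpha_attained[OF assms(1)] .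
    show ?thesis
    proof (cases "card T \<ge> 2")
      case True
      then show ?thesis using bad_sequence T by simp
    next
      case card: False
      \<comment> \<open>Here \<open>L T\<close> is 0 by convention. With only \<open>s\<close> left
        free, a request at distance 1 from \<open>s\<close> costs the algorithm at least as much as
        the optimum.\<close>
      then have "?R = 1" using T by (simp add: L_def)
      obtain s where s: "s \<in> S" using False by blast
      obtain w where "w \<in> {s}" "forceable (s + 1) ({s} - {w}) w \<bar>s + 1 - w\<bar>"
        using forceable_start[of "{s}" "s + 1"] s by blast
      then have "forceable (s + 1) {} s 1" by simp
      then show ?thesis
        by (rule bad_sequence_of_forceable) (use \<open>?R = 1\<close> in auto)
    qed
  next
    case False
    then obtain s t where "s \<in> S" "t \<in> S" "(t, s) \<notin> P s" by blast
    then show ?thesis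
      using assms(1,2) P(1,3) R
      by (intro bad_sequence_not_self_preferring[where P = P and s = s and t = t]) auto
  qed
  then obtain \<sigma> where \<sigma>: "request_sequence S c \<sigma>" "0 < alg_cost A \<sigma>"
    "?R * opt_cost S c \<sigma> \<le> alg_cost A \<sigma>"
    by blast
  have "ereal ?R \<le> competitive_ratio S c A"
    unfolding competitive_ratio_def
  proof (rule Inf_greatest)
    fix y
    assume "y \<in> {ereal \<beta> |\<beta>. 1 \<le> \<beta> \<and> competitive S c A \<beta>}"
    then obtain \<beta> where \<beta>: "y = ereal \<beta>" "1 \<le> \<beta>" "competitive S c A \<beta>" by blast
    then have le: "alg_cost A \<sigma> \<le> \<beta> * opt_cost S c \<sigma>"
      using \<sigma>(1) by (auto simp: competitive_def)
    then have "0 < \<beta> * opt_cost S c \<sigma>" using \<sigma>(2) by linarith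
    \<comment> \<open>A positive optimum can be cancelled from the comparison of \<open>?R\<close>
      with \<beta>.\<close>
    then have "0 < opt_cost S c \<sigma>" using \<beta>(2) by (simp add: zero_less_mult_iff)
    moreover have "?R * opt_cost S c \<sigma> \<le> \<beta> * opt_cost S c \<sigma>" using le \<sigma>(3) by linarith
    ultimately have "?R \<le> \<beta>" by (meson mult_right_le_imp_le)
    then show "ereal ?R \<le> y" using \<beta>(1) by simp
  qed
  then show ?thesis using \<sigma> by blast
qed

end
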